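(* Let $\mathcal{K}$ be a Mercer kernel on a set of objects $\mathcal{X}$ with induced metric $d_\mathcal{K}$, let $S\subseteq\mathcal{X}$ be finite, let $T$ be a cover tree on $S$ with respect to $d_\mathcal{K}$, let $q\in\mathcal{X}$ be such that $\max_{r\in S}\mathcal{K}(q,r)>0$, and let $\epsilon>0$. Run the algorithm FastMKS$(T,q)$ with the relative value approximation (RVA) stopping rule: at the end of the iteration at level $i$, if $\max_{r\in R_{i-1}}\mathcal{K}(q,r)\ge(2^i/\epsilon)\sqrt{\mathcal{K}(q,q)}$, stop and return the best candidate found so far, $p\in\arg\max_{r\in R_{i-1}}\mathcal{K}(q,r)$. Then the returned point $p\in S$ satisfies $\mathcal{K}(q,p)\ge(1-\epsilon)\max_{r\in S}\mathcal{K}(q,r)$.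
   Context: $\mathcal{K}(x,y)=\langle\varphi(x),\varphi(y)\rangle_{\mathcal{H}}$ for a feature map $\varphi$ into a Hilbert space $\mathcal{H}$, and $d_\mathcal{K}(x,y)=\sqrt{\mathcal{K}(x,x)+\mathcal{K}(y,y)-2\mathcal{K}(x,y)}$. A cover tree on a finite set $S$ with respect to a metric $d$ is a leveled tree with levels $C_i\subseteq S$ indexed by integers $i$ (decreasing as the tree is descended), where $C_\infty$ is a single point (the root) and $C_{-\infty}=S$, satisfying for all $i$: (nesting) $C_i\subseteq C_{i-1}$; (covering) for every $p\in C_{i-1}$ there is $q\in C_i$ with $d(p,q)\le 2^i$, and exactly one such $q$ is the parent of $p$; (separation) for all distinct $p,q\in C_i$, $d(p,q)>2^i$. The children of $r\in C_i$ are the points of $C_{i-1}$ whose parent is $r$ (including $r$). For finite $R$, $\mathcal{K}(q,R)=\max_{r\in R}\mathcal{K}(q,r)$. FastMKS$(T,q)$: set $R_\infty=C_\infty$; for $i$ from $\infty$ down to $-\infty$, let $R=\{\text{children of } r: r\in R_i\}$ and $R_{i-1}=\{r\in R:\mathcal{K}(q,r)\ge\mathcal{K}(q,R)-2^i\sqrt{\mathcal{K}(q,q)}\}$; (without stopping) return $\arg\max_{r\in R_{-\infty}}\mathcal{K}(q,r)$. *)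

theory Defs
  imports "HOL-Analysis.Inner_Product"
begin

text \<open>The Hilbert space of a feature map is the type \<open>'h\<close>, a complete real inner product space.\<close>

definition mercer_kernel_on ::
  "'a set \<Rightarrow> ('a \<Rightarrow> 'h :: {real_inner, complete_space}) \<Rightarrow> ('a \<Rightarrow> 'a \<Rightarrow> real) \<Rightarrow> bool" where
  "mercer_kernel_on X \<phi> K \<longleftrightarrow> (\<forall>x\<in>X. \<forall>y\<in>X. K x y = inner (\<phi> x) (\<phi> y))"

definition kernel_dist :: "('a \<Rightarrow> 'a \<Rightarrow> real) \<Rightarrow> 'a \<Rightarrow> 'a \<Rightarrow> real" where
  "kernel_dist K x y = sqrt (K x x + K y y - 2 * K x y)"

text \<open>
  \<open>level T i\<close> is the set $C_i$; \<open>parent T i p\<close> is the parent in $C_i$ of a point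
  \<open>p\<close> of $C_{i-1}$ (its value is irrelevant for other \<open>p\<close>).
\<close>

record 'a leveled_tree =
  level :: "int \<Rightarrow> 'a set"
  parent :: "int \<Rightarrow> 'a \<Rightarrow> 'a"

text \<open>
  Levels increase as the index decreases, so $C_\infty$ and $C_{-\infty}$ are the limits of
  $C_i$, namely the intersection and the union of all levels.
\<close>

definition top_level :: "'a leveled_tree \<Rightarrow> 'a set" where
  "top_level T = (\<Inter>i. level T i)"

definition bottom_level :: "'a leveled_tree \<Rightarrow> 'a set" where
  "bottom_level T = (\<Union>i. level T i)"

definition cover_tree :: "('a \<Rightarrow> 'a \<Rightarrow> real) \<Rightarrow> 'a set \<Rightarrow> 'a leveled_tree \<Rightarrow> bool" where
  "cover_tree d S T \<longleftrightarrow>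
     (\<exists>root. top_level T = {root}) \<and>
     bottom_level T = S \<and>
     (\<forall>i. level T i \<subseteq> level T (i - 1)) \<and>
     (\<forall>i. \<forall>p \<in> level T (i - 1). parent T i p \<in> level T i \<and> d p (parent T i p) \<le> 2 powi i) \<and>
     (\<forall>i. \<forall>p \<in> level T i. \<forall>q \<in> level T i. p \<noteq> q \<longrightarrow> d p q > 2 powi i)"

definition children :: "'a leveled_tree \<Rightarrow> int \<Rightarrow> 'a \<Rightarrow> 'a set" where
  "children T i r = {p \<in> level T (i - 1). parent T i p = r}"

text \<open>Separation forces every point to be its own parent, hence its own child.\<close>

lemma self_in_children:
  assumes "cover_tree d S T" and "r \<in> level T i"
  shows "r \<in> children T i r"
proof -
  have "r \<in> level T (i - 1)"
    using assms unfolding cover_tree_def by blast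
  then have "parent T i r \<in> level T i" and "d r (parent T i r) \<le> 2 powi i"
    using assms(1) unfolding cover_tree_def by blast+
  moreover have "d r p > 2 powi i" if "p \<in> level T i" "p \<noteq> r" for p
    using assms that unfolding cover_tree_def by metis
  ultimately have "parent T i r = r"
    by force
  with \<open>r \<in> level T (i - 1)\<close> show ?thesis
    by (simp add: children_def)
qed

text \<open>The iteration at level \<open>i\<close>, turning $R_i$ into $R_{i-1}$.\<close>

definition fastmks_step ::
  "('a \<Rightarrow> 'a \<Rightarrow> real) \<Rightarrow> 'a leveled_tree \<Rightarrow> 'a \<Rightarrow> int \<Rightarrow> 'a set \<Rightarrow> 'a set" where
  "fastmks_step K T q i A =
     (let R = (\<Union>r\<in>A. children T i r)
      in {r \<in> R. K q r \<ge> Max (K q ` R) - 2 powi i * sqrt (K q q)})"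

text \<open>
  The candidate sets $R_i$ of the run that is never stopped. The start $R_\infty = C_\infty$ is
  read as \<open>R i = top_level T\<close> at all sufficiently high levels, so the loop visits every
  integer level; this determines \<open>R\<close> uniquely.
\<close>

definition fastmks_run ::
  "('a \<Rightarrow> 'a \<Rightarrow> real) \<Rightarrow> 'a leveled_tree \<Rightarrow> 'a \<Rightarrow> (int \<Rightarrow> 'a set) \<Rightarrow> bool" where
  "fastmks_run K T q R \<longleftrightarrow>
     (\<forall>\<^sub>F i in at_top. R i = top_level T) \<and>
     (\<forall>i. R (i - 1) = fastmks_step K T q i (R i))"

text \<open>$R_{-\infty}$: the points that are candidates at all sufficiently low levels.\<close>

definition final_candidates :: "(int \<Rightarrow> 'a set) \<Rightarrow> 'a set" where
  "final_candidates R = {r. \<forall>\<^sub>F i in at_bot. r \<in> R i}"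

definition rva_stop ::
  "('a \<Rightarrow> 'a \<Rightarrow> real) \<Rightarrow> 'a \<Rightarrow> real \<Rightarrow> (int \<Rightarrow> 'a set) \<Rightarrow> int \<Rightarrow> bool" where
  "rva_stop K q \<epsilon> R i \<longleftrightarrow> Max (K q ` R (i - 1)) \<ge> (2 powi i / \<epsilon>) * sqrt (K q q)"

text \<open>
  Levels are visited in decreasing order, so the algorithm stops at the greatest \<open>i\<close> at which
  the rule applies. It is a relation because ties in the maximum may be broken arbitrarily.
\<close>

definition fastmks_rva_returns ::
  "('a \<Rightarrow> 'a \<Rightarrow> real) \<Rightarrow> 'a leveled_tree \<Rightarrow> 'a \<Rightarrow> real \<Rightarrow> 'a \<Rightarrow> bool" where
  "fastmks_rva_returns K T q \<epsilon> p \<longleftrightarrow>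
     (\<exists>R. fastmks_run K T q R \<and>
        ((\<exists>i. rva_stop K q \<epsilon> R i \<and> (\<forall>j>i. \<not> rva_stop K q \<epsilon> R j) \<and>
              is_arg_max (K q) (\<lambda>r. r \<in> R (i - 1)) p) \<or>
         ((\<forall>i. \<not> rva_stop K q \<epsilon> R i) \<and>
              is_arg_max (K q) (\<lambda>r. r \<in> final_candidates R) p)))"

end

(* The distance of a point to its ancestor at level i - 1 is at most a sum of the powers
   2 powi j with j < i, hence below 2 powi i. By Cauchy-Schwarz, K q changes by at most
   2 powi i * sqrt (K q q) along the way, which is exactly the pruning margin, so the
   ancestors of a best point p are never pruned. If the run stops at level i with
   candidate r, then K q p \<le> K q r + 2 powi i * sqrt (K q q) \<le> K q r + \<epsilon> * K q r; if it
   never stops, p itself survives to the bottom. *)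

theory Submission
  imports Defs
begin

section \<open>Kernel values and the kernel distance\<close>

text \<open>\<open>kernel_dist K x y\<close> is the norm of \<open>\<phi> x - \<phi> y\<close> and
  \<open>sqrt (K q q)\<close> is the norm of \<open>\<phi> q\<close>, so this is
  Cauchy-Schwarz.\<close>

lemma mercer_kernel_lipschitz:
  assumes "mercer_kernel_on X \<phi> K" "q \<in> X" "x \<in> X" "y \<in> X"
  shows "K q x \<le> K q y + kernel_dist K x y * sqrt (K q q)"
proof -
  have "kernel_dist K x y = norm (\<phi> x - \<phi> y)" "sqrt (K q q) = norm (\<phi> q)"
    using assms
    by (simp_all add: mercer_kernel_on_def kernel_dist_def norm_eq_sqrt_inner
        inner_diff_left inner_diff_right inner_commute algebra_simps)
  moreover have "K q x - K q y = inner (\<phi> q) (\<phi> x - \<phi> y)"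
    using assms by (simp add: mercer_kernel_on_def inner_diff_right)
  ultimately show ?thesis
    using norm_cauchy_schwarz[of "\<phi> q" "\<phi> x - \<phi> y"] by (simp add: mult.commute)
qed

section \<open>Levels of a cover tree near both ends\<close>

text \<open>A point of the union, once in, stays in at all lower indices; a point outside the
  intersection, once out, stays out at all higher ones. Finitely many points share a common
  threshold. Hence a finite cover tree attains both limits of its levels.\<close>

lemma antitone_family_eventually_const:
  fixes f :: "int \<Rightarrow> 'a set"
  assumes "antimono f" "finite (\<Union>i. f i)"
  shows "\<forall>\<^sub>F i in at_bot. f i = (\<Union>i. f i)" and "\<forall>\<^sub>F i in at_top. f i = (\<Inter>i. f i)"
proof -
  let ?U = "\<Union>i. f i" and ?I = "\<Inter>i. f i"
  have "\<forall>\<^sub>F i in at_bot. x \<in> f i" if "x \<in> ?U" for x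
    using that assms(1) by (fastforce simp: eventually_at_bot_linorder dest: antimonoD)
  then have "\<forall>\<^sub>F i in at_bot. \<forall>x\<in>?U. x \<in> f i"
    by (intro eventually_ball_finite assms(2)) blast
  then show "\<forall>\<^sub>F i in at_bot. f i = ?U"
    by eventually_elim blast
  have "\<forall>\<^sub>F i in at_top. x \<notin> f i" if "x \<in> ?U - ?I" for x
    using that assms(1) by (fastforce simp: eventually_at_top_linorder dest: antimonoD)
  then have "\<forall>\<^sub>F i in at_top. \<forall>x\<in>?U - ?I. x \<notin> f i"
    by (intro eventually_ball_finite finite_Diff assms(2)) blast
  then show "\<forall>\<^sub>F i in at_top. f i = ?I"
    by eventually_elim blast
qed

lemma cover_tree_antimono:
  assumes "cover_tree d S T"
  shows "antimono (level T)"
proof (rule antimonoI)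
  fix i j :: int
  assume "i \<le> j"
  then show "level T j \<subseteq> level T i"
    by (induction i rule: int_le_induct) (use assms in \<open>auto simp: cover_tree_def\<close>)
qed

lemma cover_tree_bottom:
  assumes "cover_tree d S T" "finite S"
  shows "\<forall>\<^sub>F i in at_bot. level T i = S"
  using antitone_family_eventually_const(1)[OF cover_tree_antimono[OF assms(1)]] assms
  by (simp add: cover_tree_def bottom_level_def)

lemma cover_tree_top:
  assumes "cover_tree d S T" "finite S"
  shows "\<forall>\<^sub>F i in at_top. level T i = top_level T"
  using antitone_family_eventually_const(2)[OF cover_tree_antimono[OF assms(1)]] assms
  by (simp add: cover_tree_def bottom_level_def top_level_def)

lemma cover_tree_level_subset:
  assumes "cover_tree d S T"
  shows "level T i \<subseteq> S"
  using assms by (auto simp: cover_tree_def bottom_level_def)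

section \<open>Ancestor chains\<close>

text \<open>The chain is indexed by all integers, as the run is, so it needs no lowest level: far
  down it stays at \<open>p\<close>. Links are stated through \<open>children\<close>, the form in
  which a step of the algorithm follows them.\<close>

definition ancestor_chain :: "'a leveled_tree \<Rightarrow> 'a \<Rightarrow> (int \<Rightarrow> 'a) \<Rightarrow> bool" where
  "ancestor_chain T p c \<longleftrightarrow>
     (\<forall>i. c i \<in> level T i \<and> c (i - 1) \<in> children T i (c i)) \<and> (\<forall>\<^sub>F i in at_bot. c i = p)"

lemma ancestor_chain_exists:
  assumes T: "cover_tree d S T" and "finite S" and "p \<in> S"
  obtains c where "ancestor_chain T p c"
proof -
  obtain m where m: "level T i = S" if "i \<le> m" for i
    using cover_tree_bottom[OF T \<open>finite S\<close>] by (auto simp: eventually_at_bot_linorder)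
  \<comment> \<open>\<open>F n\<close> is the ancestor of \<open>p\<close> at level
    \<open>m + int n\<close>.\<close>
  define F where "F = rec_nat p (\<lambda>n. parent T (m + int n + 1))"
  have F_Suc: "F (Suc n) = parent T (m + int n + 1) (F n)" for n
    by (simp add: F_def)
  have F_level: "F n \<in> level T (m + int n)" for n
  proof (induction n)
    case 0
    then show ?case using m[of m] \<open>p \<in> S\<close> by (simp add: F_def)
  next
    case (Suc n)
    then have "F n \<in> level T ((m + int n + 1) - 1)" by simp
    then have "parent T (m + int n + 1) (F n) \<in> level T (m + int n + 1)"
      using T unfolding cover_tree_def by blast
    then show ?case by (simp add: F_Suc ac_simps)
  qed
  \<comment> \<open>\<open>nat\<close> truncates at 0, so the chain is constantly \<open>p\<close>
    from level \<open>m\<close> down.\<close>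
  define c where "c i = F (nat (i - m))" for i
  have low: "c i = p" if "i \<le> m" for i
    using that by (simp add: c_def F_def)
  have "c i \<in> level T i \<and> c (i - 1) \<in> children T i (c i)" for i
  proof (cases "i \<le> m")
    case True
    then have "p \<in> level T i" using m \<open>p \<in> S\<close> by simp
    then show ?thesis using low[of i] low[of "i - 1"] True self_in_children[OF T] by simp
  next
    case False
    define n where "n = nat (i - 1 - m)"
    have i: "i = m + int n + 1" using False by (simp add: n_def)
    have "c i = F (Suc n)" "c (i - 1) = F n" by (simp_all add: c_def i nat_add_distrib)
    then show ?thesis using F_level[of n] F_level[of "Suc n"]
      by (simp add: i F_Suc children_def ac_simps)
  qed
  moreover have "\<forall>\<^sub>F i in at_bot. c i = p"
    using low by (auto simp: eventually_at_bot_linorder)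
  ultimately have "ancestor_chain T p c" unfolding ancestor_chain_def by blast
  then show ?thesis by (rule that)
qed

text \<open>The link from level \<open>j - 1\<close> to level \<open>j\<close> costs at most
  \<open>2 powi j * sqrt (K q q)\<close>. Links far below are trivial, and the powers
  \<open>2 powi j\<close> with \<open>j \<le> i\<close> sum to
  \<open>2 powi (i + 1)\<close>.\<close>

lemma ancestor_chain_kernel_bound:
  assumes K: "mercer_kernel_on X \<phi> K" and "S \<subseteq> X" and T: "cover_tree (kernel_dist K) S T"
    and "q \<in> X" and c: "ancestor_chain T p c"
  shows "K q p \<le> K q (c i) + 2 powi (i + 1) * sqrt (K q q)"
proof -
  have sqrt_nonneg: "sqrt (K q q) \<ge> 0"
    using K \<open>q \<in> X\<close> by (simp add: mercer_kernel_on_def)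
  obtain m where m: "c i = p" if "i \<le> m" for i
    using c by (auto simp: ancestor_chain_def eventually_at_bot_linorder)
  have "K q p \<le> K q (c i) + 2 powi (i + 1) * sqrt (K q q)" if "i \<ge> m" for i
    using that
  proof (induction i rule: int_ge_induct)
    case base
    then show ?case using m[of m] sqrt_nonneg by simp
  next
    case (step i)
    have level: "c i \<in> level T i" "c (i + 1) \<in> level T (i + 1)" for i
      using c by (auto simp: ancestor_chain_def)
    have "c (i + 1 - 1) \<in> children T (i + 1) (c (i + 1))"
      using c unfolding ancestor_chain_def by blast
    then have parent: "c i \<in> level T (i + 1 - 1)" "parent T (i + 1) (c i) = c (i + 1)"
      by (simp_all add: children_def)
    then have dist: "kernel_dist K (c i) (c (i + 1)) \<le> 2 powi (i + 1)"
      using T unfolding cover_tree_def by metis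
    have "c i \<in> X" "c (i + 1) \<in> X"
      using level cover_tree_level_subset[OF T] \<open>S \<subseteq> X\<close> by blast+
    then have "K q (c i) \<le> K q (c (i + 1)) + kernel_dist K (c i) (c (i + 1)) * sqrt (K q q)"
      by (rule mercer_kernel_lipschitz[OF K \<open>q \<in> X\<close>])
    also have "\<dots> \<le> K q (c (i + 1)) + 2 powi (i + 1) * sqrt (K q q)"
      using dist sqrt_nonneg by (intro add_left_mono mult_right_mono)
    \<comment> \<open>The bound accumulated so far and the cost of the new link are the same power
      of two, so the slack doubles.\<close>
    finally have "K q p \<le> K q (c (i + 1)) + 2 * 2 powi (i + 1) * sqrt (K q q)"
      using step.IH by simp
    also have "2 * 2 powi (i + 1) = (2 powi (i + 1 + 1) :: real)"
      by (simp add: power_int_add)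
    finally show ?case .
  qed
  moreover have ?thesis if "i < m"
    using m[of i] that sqrt_nonneg by simp
  ultimately show ?thesis by force
qed

section \<open>Candidate sets of a run\<close>

lemma fastmks_run_subset_level:
  assumes "fastmks_run K T q R"
  shows "R i \<subseteq> level T i"
proof -
  \<comment> \<open>There is no first level, so every candidate set is the output of a step.\<close>
  have "R (i + 1 - 1) = fastmks_step K T q (i + 1) (R (i + 1))"
    using assms unfolding fastmks_run_def by blast
  then show ?thesis by (auto simp: fastmks_step_def children_def Let_def)
qed

text \<open>Descending induction from a level where the candidates are the whole level. The pruning
  threshold is at most \<open>K q p\<close> minus the margin, since \<open>p\<close> is best in
  \<open>S\<close>, and the ancestor of \<open>p\<close> reaches that value.\<close>

lemma fastmks_run_keeps_ancestors:
  assumes K: "mercer_kernel_on X \<phi> K" and "S \<subseteq> X" and "finite S"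
    and T: "cover_tree (kernel_dist K) S T" and "q \<in> X"
    and c: "ancestor_chain T p c" and p: "\<And>s. s \<in> S \<Longrightarrow> K q s \<le> K q p"
    and R: "fastmks_run K T q R"
  shows "c i \<in> R i"
proof -
  have "\<forall>\<^sub>F i in at_top. R i = level T i"
    using R cover_tree_top[OF T \<open>finite S\<close>] unfolding fastmks_run_def
    by (auto elim: eventually_elim2)
  then obtain N where N: "R i = level T i" if "i \<ge> N" for i
    by (auto simp: eventually_at_top_linorder)
  have high: "c i \<in> R i" if "i \<ge> N" for i
    using N that c by (simp add: ancestor_chain_def)
  have "c i \<in> R i" if "i \<le> N" for i
    using that
  proof (induction i rule: int_le_induct)
    case base
    then show ?case using high by simp
  next
    case (step i)
    let ?R = "\<Union>r\<in>R i. children T i r"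
    have child: "c (i - 1) \<in> ?R"
      using step.IH c by (auto simp: ancestor_chain_def)
    have "?R \<subseteq> S"
      using cover_tree_level_subset[OF T] by (fastforce simp: children_def)
    then have "Max (K q ` ?R) \<le> K q p"
      using child p \<open>finite S\<close> by (intro Max.boundedI) (auto intro: finite_subset)
    also have "\<dots> \<le> K q (c (i - 1)) + 2 powi i * sqrt (K q q)"
      using ancestor_chain_kernel_bound[OF K \<open>S \<subseteq> X\<close> T \<open>q \<in> X\<close> c, of "i - 1"] by simp
    finally have "c (i - 1) \<in> fastmks_step K T q i (R i)"
      using child by (simp add: fastmks_step_def Let_def)
    then show ?case using R by (simp add: fastmks_run_def)
  qed
  then show ?thesis using high[of i] by (cases "i \<le> N") auto
qed

section \<open>Existence of a run and of a returned point\<close>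

text \<open>Recursion needs a starting level, whereas a run has none. Start at a level
  \<open>N\<close> from which on only the root is left, and check that the steps above
  \<open>N\<close> fix \<open>{root}\<close>.\<close>

lemma fastmks_run_exists:
  assumes T: "cover_tree d S T" and "finite S" and "K q q \<ge> 0"
  obtains R where "fastmks_run K T q R"
proof -
  obtain root where root: "top_level T = {root}"
    using T by (auto simp: cover_tree_def)
  obtain N where N: "level T i = {root}" if "i \<ge> N" for i
    using cover_tree_top[OF T \<open>finite S\<close>] root by (auto simp: eventually_at_top_linorder)
  define F where "F = rec_nat {root} (\<lambda>n. fastmks_step K T q (N - int n))"
  define R where "R i = F (nat (N - i))" for i
  have high: "R i = {root}" if "i \<ge> N" for i
    using that by (simp add: R_def F_def)
  have "R (i - 1) = fastmks_step K T q i (R i)" for i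
  proof (cases "i \<le> N")
    case True
    then have "nat (N - (i - 1)) = Suc (nat (N - i))" by simp
    then show ?thesis using True by (simp add: R_def F_def)
  next
    case False
    \<comment> \<open>For \<open>i > N\<close>, the levels \<open>i\<close> and \<open>i - 1\<close>
      both consist of the root alone.\<close>
    then have "children T i root = {root}"
      using N[of i] N[of "i - 1"] self_in_children[OF T, of root i]
      by (auto simp: children_def)
    \<comment> \<open>A nonnegative margin keeps the only candidate.\<close>
    then have "fastmks_step K T q i {root} = {root}"
      using \<open>K q q \<ge> 0\<close> by (auto simp: fastmks_step_def)
    then show ?thesis using False high[of i] high[of "i - 1"] by simp
  qed
  moreover have "\<forall>\<^sub>F i in at_top. R i = top_level T"
    using high root by (auto simp: eventually_at_top_linorder)
  ultimately have "fastmks_run K T q R" by (simp add: fastmks_run_def)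
  then show ?thesis by (rule that)
qed

text \<open>High up, the best candidate value is constantly that of the root while the stopping
  threshold grows without bound. Thus the stopping levels are bounded above and, if there are any, a
  greatest one exists.\<close>

lemma fastmks_run_not_stopped_high:
  assumes T: "cover_tree d S T" and R: "fastmks_run K T q R" and "K q q > 0" and "\<epsilon> > 0"
  shows "\<forall>\<^sub>F i in at_top. \<not> rva_stop K q \<epsilon> R i"
proof -
  obtain root where root: "top_level T = {root}"
    using T by (auto simp: cover_tree_def)
  obtain N where N: "R i = {root}" if "i \<ge> N" for i
    using R root by (auto simp: fastmks_run_def eventually_at_top_linorder)
  obtain n where n: "\<epsilon> * K q root / sqrt (K q q) < 2 ^ n"
    using real_arch_pow[of 2] by auto
  \<comment> \<open>\<open>N + 1\<close> because the rule at level \<open>i\<close> inspects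
    \<open>R (i - 1)\<close>.\<close>
  have "\<not> rva_stop K q \<epsilon> R i" if "i \<ge> max (N + 1) (int n)" for i
  proof -
    have "(2::real) ^ n \<le> 2 powi i"
      using that power_int_increasing[of "int n" i "2::real"] by simp
    with n have "\<epsilon> * K q root / sqrt (K q q) < 2 powi i" by linarith
    then have "K q root < (2 powi i / \<epsilon>) * sqrt (K q q)"
      using \<open>K q q > 0\<close> \<open>\<epsilon> > 0\<close> by (simp add: field_simps)
    then show ?thesis using N[of "i - 1"] that by (simp add: rva_stop_def)
  qed
  then show ?thesis unfolding eventually_at_top_linorder by blast
qed

lemma is_arg_max_finite_exists:
  fixes f :: "'a \<Rightarrow> 'b :: linorder"
  assumes "finite A" "A \<noteq> {}"
  shows "\<exists>x. is_arg_max f (\<lambda>x. x \<in> A) x"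
proof -
  have "Max (f ` A) \<in> f ` A" using assms by simp
  then obtain x where "x \<in> A" "f x = Max (f ` A)" by auto
  then show ?thesis using assms by (auto simp: is_arg_max_linorder)
qed

lemma fastmks_rva_returns_exists:
  assumes R: "fastmks_run K T q R" and ne: "\<And>i. R i \<noteq> {}" "final_candidates R \<noteq> {}"
    and fin: "\<And>i. finite (R i)" "finite (final_candidates R)"
    and high: "\<forall>\<^sub>F i in at_top. \<not> rva_stop K q \<epsilon> R i"
  shows "\<exists>p. fastmks_rva_returns K T q \<epsilon> p"
proof (cases "\<exists>i. rva_stop K q \<epsilon> R i")
  case True
  then obtain i0 where i0: "rva_stop K q \<epsilon> R i0" by blast
  obtain N where N: "\<not> rva_stop K q \<epsilon> R i" if "i > N" for i
    using high by (auto simp: eventually_at_top_dense)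
  \<comment> \<open>Cutting off below the known stopping level \<open>i0\<close> makes the set
    finite without changing its maximum.\<close>
  let ?A = "{i. i0 \<le> i \<and> rva_stop K q \<epsilon> R i}"
  have "?A \<subseteq> {i0..N}"
    using N by force
  then have A: "finite ?A" "?A \<noteq> {}"
    using i0 by (auto intro: finite_subset)
  then have stop: "rva_stop K q \<epsilon> R (Max ?A)" and "i0 \<le> Max ?A"
    using Max_in[OF A] by blast+
  moreover have "\<not> rva_stop K q \<epsilon> R j" if "j > Max ?A" for j
  proof
    assume "rva_stop K q \<epsilon> R j"
    then have "j \<in> ?A" using that \<open>i0 \<le> Max ?A\<close> by simp
    then have "j \<le> Max ?A" using A by simp
    then show False using that by simp
  qed
  ultimately show ?thesis
    using R is_arg_max_finite_exists[OF fin(1) ne(1)] unfolding fastmks_rva_returns_def by blast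
next
  case False
  then show ?thesis
    using R is_arg_max_finite_exists[OF fin(2) ne(2)] unfolding fastmks_rva_returns_def by blast
qed

theorem theorem4p5:
  fixes X S :: "'a set"
    and \<phi> :: "'a \<Rightarrow> 'h :: {real_inner, complete_space}"
    and K :: "'a \<Rightarrow> 'a \<Rightarrow> real"
    and T :: "'a leveled_tree"
    and q :: 'a
    and \<epsilon> :: real
  assumes "mercer_kernel_on X \<phi> K"
    and "S \<subseteq> X" and "finite S"
    and "cover_tree (kernel_dist K) S T"
    and "q \<in> X"
    and "Max (K q ` S) > 0"
    and "\<epsilon> > 0"
  shows "(\<exists>p. fastmks_rva_returns K T q \<epsilon> p) \<and>
         (\<forall>p. fastmks_rva_returns K T q \<epsilon> p \<longrightarrow>
            p \<in> S \<and> K q p \<ge> (1 - \<epsilon>) * Max (K q ` S))"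
proof -
  note K = assms(1) and T = assms(4)
  have "top_level T \<subseteq> S" "top_level T \<noteq> {}"
    using T cover_tree_level_subset[OF T] by (auto simp: top_level_def cover_tree_def)
  then have "S \<noteq> {}" by blast
  then have "Max (K q ` S) \<in> K q ` S" using \<open>finite S\<close> by simp
  then obtain p where "p \<in> S" and p_Max: "Max (K q ` S) = K q p" by blast
  have p_max: "K q s \<le> K q p" if "s \<in> S" for s
    using that \<open>finite S\<close> by (simp flip: p_Max)
  have "K q p = inner (\<phi> q) (\<phi> p)" "K q q = inner (\<phi> q) (\<phi> q)"
    using K \<open>q \<in> X\<close> \<open>p \<in> S\<close> \<open>S \<subseteq> X\<close> by (auto simp: mercer_kernel_on_def)
  \<comment> \<open>If \<open>K q q\<close> were 0, then \<open>\<phi> q\<close> would be 0, and so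
    would the positive value \<open>K q p\<close>.\<close>
  then have "K q q > 0"
    using assms(6) p_Max by auto
  obtain c where c: "ancestor_chain T p c"
    using ancestor_chain_exists[OF T \<open>finite S\<close> \<open>p \<in> S\<close>] .
  have kept: "c i \<in> R i" if "fastmks_run K T q R" for R i
    using fastmks_run_keeps_ancestors[OF K \<open>S \<subseteq> X\<close> \<open>finite S\<close> T \<open>q \<in> X\<close> c p_max that] .
  have p_final: "p \<in> final_candidates R" if "fastmks_run K T q R" for R
    using c kept[OF that] unfolding final_candidates_def ancestor_chain_def
    by (auto elim: eventually_mono)
  have R_sub: "R i \<subseteq> S" if "fastmks_run K T q R" for R i
    using fastmks_run_subset_level[OF that] cover_tree_level_subset[OF T] by blast
  have final_sub: "final_candidates R \<subseteq> S" if "fastmks_run K T q R" for R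
    using R_sub[OF that] by (auto simp: final_candidates_def eventually_at_bot_linorder)
  obtain R where R: "fastmks_run K T q R"
    using fastmks_run_exists[where K = K and q = q, OF T \<open>finite S\<close>] \<open>K q q > 0\<close> by auto
  have "\<exists>r. fastmks_rva_returns K T q \<epsilon> r"
  proof (rule fastmks_rva_returns_exists[OF R])
    show "R i \<noteq> {}" "finite (R i)" for i
      using kept[OF R] R_sub[OF R] \<open>finite S\<close> by (auto intro: finite_subset)
    show "final_candidates R \<noteq> {}" "finite (final_candidates R)"
      using p_final[OF R] final_sub[OF R] \<open>finite S\<close> by (auto intro: finite_subset)
    show "\<forall>\<^sub>F i in at_top. \<not> rva_stop K q \<epsilon> R i"
      using fastmks_run_not_stopped_high[OF T R \<open>K q q > 0\<close> \<open>\<epsilon> > 0\<close>] .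
  qed
  moreover have "r \<in> S \<and> K q r \<ge> (1 - \<epsilon>) * Max (K q ` S)"
    if "fastmks_rva_returns K T q \<epsilon> r" for r
  proof -
    from that obtain R where R: "fastmks_run K T q R" and
      "(\<exists>i. rva_stop K q \<epsilon> R i \<and> is_arg_max (K q) (\<lambda>r. r \<in> R (i - 1)) r) \<or>
       is_arg_max (K q) (\<lambda>r. r \<in> final_candidates R) r"
      unfolding fastmks_rva_returns_def by blast
    then consider
      (stop) i where "rva_stop K q \<epsilon> R i" "is_arg_max (K q) (\<lambda>r. r \<in> R (i - 1)) r"
      | (final) "is_arg_max (K q) (\<lambda>r. r \<in> final_candidates R) r"
      by blast
    then show ?thesis
    proof cases
      case stop
      then have r: "r \<in> R (i - 1)" "\<And>s. s \<in> R (i - 1) \<Longrightarrow> K q s \<le> K q r"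
        by (auto simp: is_arg_max_linorder)
      then have "r \<in> S" "finite (R (i - 1))"
        using R_sub[OF R] \<open>finite S\<close> by (auto intro: finite_subset)
      then have "Max (K q ` R (i - 1)) = K q r"
        using r by (intro Max_eqI) auto
      \<comment> \<open>The stopping rule bounds the possible loss along the ancestors of
        \<open>p\<close> by \<open>\<epsilon> * K q r\<close>.\<close>
      then have "2 powi i * sqrt (K q q) \<le> \<epsilon> * K q r"
        using stop(1) \<open>\<epsilon> > 0\<close> by (simp add: rva_stop_def field_simps)
      moreover have "K q p \<le> K q (c (i - 1)) + 2 powi i * sqrt (K q q)"
        using ancestor_chain_kernel_bound[OF K \<open>S \<subseteq> X\<close> T \<open>q \<in> X\<close> c, of "i - 1"] by simp
      moreover have "K q (c (i - 1)) \<le> K q r"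
        using r(2) kept[OF R] .
      \<comment> \<open>This turns an error relative to the returned value into one relative to the
        optimum.\<close>
      moreover have "\<epsilon> * K q r \<le> \<epsilon> * K q p"
        using p_max[OF \<open>r \<in> S\<close>] \<open>\<epsilon> > 0\<close> by simp
      ultimately show ?thesis
        using \<open>r \<in> S\<close> by (simp add: p_Max algebra_simps)
    next
      case final
      then have "r \<in> S" "K q p \<le> K q r"
        using final_sub[OF R] p_final[OF R]
        by (auto simp: is_arg_max_linorder)
      \<comment> \<open>Here \<open>r\<close> is an exact maximizer, and the factor
        \<open>1 - \<epsilon>\<close> only lowers the positive optimum.\<close>
      moreover have "\<epsilon> * K q p \<ge> 0"
        using assms(6) p_Max \<open>\<epsilon> > 0\<close> by simp
      ultimately show ?thesis
        by (simp add: p_Max algebra_simps)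
    qed
  qed
  ultimately show ?thesis by blast
qed

end
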